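(* Let $I(z)=\frac{1}{1-z}$ ($z\in\mathbb D$), so that $I\star I=I$. There exist two analytic functions $F_1,F_2$ in $\mathbb D$ with $$\bigl(\log|F_j|\bigr)^*\le\bigl(\log|I|\bigr)^*\ \text{ in } \mathbb D^+,\qquad j=1,2,$$ and such that the inequality $\bigl(\log|F_1\star F_2|\bigr)^*\le\bigl(\log|I\star I|\bigr)^*$ in $\mathbb D^+$ does not hold.
   Context: $\mathbb D=\{z\in\mathbb C:|z|<1\}$ and $\mathbb D^+=\{re^{i\theta}:0<r<1,\ 0<\theta<\pi\}$. For $f(z)=\sum_{n\ge0}a_nz^n$ and $g(z)=\sum_{n\ge0}b_nz^n$ analytic in $\mathbb D$, the (Hadamard) convolution is $(f\star g)(z)=\sum_{n\ge0}a_nb_nz^n$, $z\in\mathbb D$; the function $I$ is the identity for $\star$. If $u$ is subharmonic in $\mathbb D\setminus\{0\}$, its Baernstein star-function is $$u^*(re^{i\theta})=\sup_{|E|=2\theta}\int_E u(re^{it})\,dt,\qquad 0<r<1,\ 0\le\theta\le\pi,$$ where the supremum is over measurable sets $E\subset[-\pi,\pi]$ and $|E|$ is the Lebesgue measure of $E$. The star-function is applied to $u=\log|f|$ with $f$ analytic and not identically zero (a subharmonic function). An inequality $u^*\le v^*$ between star-functions means that it holds at every point of $\mathbb D^+$; saying it does not hold means that it fails at some point of $\mathbb D^+$. *)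

theory Defs
  imports "HOL-Complex_Analysis.Complex_Analysis"
begin

definition upper_half_disk :: "complex set" where
  "upper_half_disk =
     {of_real r * cis \<theta> | r \<theta>. 0 < r \<and> r < 1 \<and> 0 < \<theta> \<and> \<theta> < pi}"

definition hadamard_conv :: "(complex \<Rightarrow> complex) \<Rightarrow> (complex \<Rightarrow> complex) \<Rightarrow> complex \<Rightarrow> complex"
    (infixl "\<star>" 70) where
  "f \<star> g =
     (\<lambda>z. \<Sum>n. fps_nth (fps_expansion f 0) n * fps_nth (fps_expansion g 0) n * z ^ n)"

definition conv_identity :: "complex \<Rightarrow> complex" where
  "conv_identity z = 1 / (1 - z)"

(* Since ln 0 = 0 in HOL, log_mod f is 0 rather than minus infinity at the zeros of f.
   If f is analytic and not identically zero, only finitely many points of each circle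
   |z| = r < 1 are affected, so the integrals in baernstein_star are unchanged. *)
definition log_mod :: "(complex \<Rightarrow> complex) \<Rightarrow> complex \<Rightarrow> real" where
  "log_mod f = (\<lambda>z. ln (cmod (f z)))"

(* The value u^*(r e^{i theta}) at z = r e^{i theta}, with 0 < r < 1 and 0 <= theta <= pi;
   then cmod z = r and Arg z = theta.  For u = log |f|, with f analytic in the unit disk and
   not identically zero, u is integrable and bounded above on the circle |w| = r, and
   {-theta..theta} is an admissible set E.  So the integrals are genuine and the real
   supremum is taken over a nonempty set that is bounded above. *)
definition baernstein_star :: "(complex \<Rightarrow> real) \<Rightarrow> complex \<Rightarrow> real" where
  "baernstein_star u z =
     (SUP E \<in> {E. E \<in> sets lebesgue \<and> E \<subseteq> {-pi..pi} \<and> measure lebesgue E = 2 * Arg z}.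
        LINT t:E|lebesgue. u (of_real (cmod z) * cis t))"

end

theory Submission
  imports Defs
begin

text \<open>
  If \<open>\<bar>\<omega>\<bar> \<le> 1\<close> then \<open>F = \<omega> I\<close> satisfies \<open>log \<bar>F\<bar> \<le> log \<bar>I\<bar>\<close> pointwise, yet its first
  coefficient \<open>\<omega>\<^sub>0 + \<omega>\<^sub>1\<close> may exceed 1: for \<open>\<omega>(z) = ((1 + z) / 2)\<^bsup>1/2\<^esup>\<close> it equals
  \<open>a = 3 / (2 \<surd>2)\<close>. Take this \<open>F\<close> and the function \<open>z\<close>. The star-function of \<open>log \<bar>z\<bar>\<close> is
  negative, while that of \<open>log \<bar>I\<bar>\<close> is nonnegative. But \<open>F \<star> z = a z\<close>, and for \<open>r\<close> close to 1
  the number \<open>log (a r)\<close> is positive, so the star-function of \<open>log \<bar>a z\<bar>\<close>, which is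
  \<open>2 \<theta> log (a r)\<close>, stays away from 0 as \<open>\<theta> \<rightarrow> \<pi>\<close>, whereas that of \<open>log \<bar>I\<bar>\<close> tends to the
  circular mean 0.
\<close>

section \<open>Admissible sets and general properties of the star-function\<close>

lemma upper_half_diskD:
  assumes "z \<in> upper_half_disk"
  shows "0 < cmod z" "cmod z < 1" "0 < Arg z" "Arg z < pi"
  using assms by (auto simp: upper_half_disk_def norm_mult Arg_cis)

text \<open>For \<open>l = 2 * Arg z\<close> this is the index set of the supremum in
  \<open>baernstein_star\<close>; rewriting with the reversed definition folds the supremum into
  this form.\<close>

definition sets_of_length :: "real \<Rightarrow> real set set" where
  "sets_of_length l = {E. E \<in> sets lebesgue \<and> E \<subseteq> {-pi..pi} \<and> measure lebesgue E = l}"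

lemma symmetric_interval_in_sets_of_length:
  assumes "0 \<le> \<theta>" "\<theta> \<le> pi"
  shows "{-\<theta>..\<theta>} \<in> sets_of_length (2 * \<theta>)"
  using assms by (auto simp: sets_of_length_def)

lemma lmeasurable_sets_of_length:
  assumes "E \<in> sets_of_length l"
  shows "E \<in> lmeasurable"
proof (rule bounded_set_imp_lmeasurable)
  show "bounded E"
    by (rule bounded_subset[of "{-pi..pi}"]) (use assms in \<open>auto simp: sets_of_length_def\<close>)
  show "E \<in> sets lebesgue"
    using assms by (simp add: sets_of_length_def)
qed

lemma set_integrable_sets_of_length:
  fixes \<phi> :: "real \<Rightarrow> real"
  assumes "set_integrable lebesgue {-pi..pi} \<phi>" "E \<in> sets_of_length l"
  shows "set_integrable lebesgue E \<phi>"
  using assms by (intro set_integrable_subset[OF assms(1)]) (auto simp: sets_of_length_def)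

lemma set_integral_const_sets_of_length:
  fixes c :: real
  assumes "E \<in> sets_of_length l"
  shows "(LINT t:E|lebesgue. c) = l * c"
proof -
  have "E \<in> sets lebesgue" "emeasure lebesgue E \<noteq> \<infinity>"
    using lmeasurable_sets_of_length[OF assms] by (auto simp: fmeasurable_def)
  then have "(LINT t:E|lebesgue. c) = measure lebesgue E *\<^sub>R c"
    by (rule set_integral_const)
  with assms show ?thesis by (simp add: sets_of_length_def)
qed

abbreviation circle_integrable :: "(complex \<Rightarrow> real) \<Rightarrow> real \<Rightarrow> bool" where
  "circle_integrable u r \<equiv> set_integrable lebesgue {-pi..pi} (\<lambda>t. u (of_real r * cis t))"

text \<open>A real supremum dominates its members only when they are bounded above. Here the
  integral of the absolute value over the whole circle is a bound independent of the set.\<close>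

lemma set_integral_le_baernstein_star:
  assumes u: "circle_integrable u (cmod z)" and E: "E \<in> sets_of_length (2 * Arg z)"
  shows "(LINT t:E|lebesgue. u (of_real (cmod z) * cis t)) \<le> baernstein_star u z"
proof -
  let ?\<phi> = "\<lambda>t. u (of_real (cmod z) * cis t)"
  have "(LINT t:A|lebesgue. ?\<phi> t) \<le> (LINT t:{-pi..pi}|lebesgue. \<bar>?\<phi> t\<bar>)"
    if A: "A \<in> sets_of_length (2 * Arg z)" for A
  proof -
    have "set_integrable lebesgue {-pi..pi} (\<lambda>t. \<bar>?\<phi> t\<bar>)"
      using u by (rule set_integrable_abs)
    with set_integrable_sets_of_length[OF u A] A show ?thesis
      unfolding set_lebesgue_integral_def set_integrable_def
      by (intro integral_mono) (auto simp: indicator_def sets_of_length_def)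
  qed
  then show ?thesis
    using E unfolding baernstein_star_def sets_of_length_def[symmetric]
    by (intro cSUP_upper bdd_aboveI2)
qed

lemma baernstein_star_le:
  assumes "z \<in> upper_half_disk"
    and "\<And>E. E \<in> sets_of_length (2 * Arg z) \<Longrightarrow>
           (LINT t:E|lebesgue. u (of_real (cmod z) * cis t)) \<le> B"
  shows "baernstein_star u z \<le> B"
  unfolding baernstein_star_def sets_of_length_def[symmetric]
  using assms symmetric_interval_in_sets_of_length[of "Arg z"] upper_half_diskD(3,4)[OF assms(1)]
  by (intro cSUP_least) auto

lemma baernstein_star_mono:
  assumes z: "z \<in> upper_half_disk"
    and u: "circle_integrable u (cmod z)" and v: "circle_integrable v (cmod z)"
    and le: "\<And>w. cmod w < 1 \<Longrightarrow> u w \<le> v w"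
  shows "baernstein_star u z \<le> baernstein_star v z"
proof (rule baernstein_star_le[OF z])
  fix E assume E: "E \<in> sets_of_length (2 * Arg z)"
  have "(LINT t:E|lebesgue. u (of_real (cmod z) * cis t)) \<le>
        (LINT t:E|lebesgue. v (of_real (cmod z) * cis t))"
    using E u v upper_half_diskD(2)[OF z]
    by (intro set_integral_mono set_integrable_sets_of_length[OF _ E] le)
      (auto simp: norm_mult)
  also have "\<dots> \<le> baernstein_star v z"
    by (rule set_integral_le_baernstein_star[OF v E])
  finally show "(LINT t:E|lebesgue. u (of_real (cmod z) * cis t)) \<le> baernstein_star v z" .
qed

lemma baernstein_star_cong:
  assumes "z \<in> upper_half_disk" and "\<And>w. cmod w < 1 \<Longrightarrow> u w = v w"
  shows "baernstein_star u z = baernstein_star v z"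
  using assms upper_half_diskD(2)[OF assms(1)]
  by (simp add: baernstein_star_def norm_mult)

text \<open>Without zeros, the logarithm of the modulus is continuous on the compact circle.\<close>

lemma circle_integrable_log_mod:
  assumes "f holomorphic_on ball 0 1" "\<And>w. cmod w < 1 \<Longrightarrow> f w \<noteq> 0"
    and "0 < r" "r < 1"
  shows "circle_integrable (log_mod f) r"
proof (rule absolutely_integrable_continuous_real)
  have "continuous_on {-pi..pi} (\<lambda>t. f (of_real r * cis t))"
    using assms(3,4)
    by (intro continuous_on_compose2[OF holomorphic_on_imp_continuous_on[OF assms(1)]]
        continuous_intros) (auto simp: norm_mult)
  then show "continuous_on {-pi..pi} (\<lambda>t. log_mod f (of_real r * cis t))"
    unfolding log_mod_def using assms(2-4)
    by (intro continuous_intros) (auto simp: norm_mult)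
qed

section \<open>Star-functions of log |I| and of monomials\<close>

lemma conv_identity_holomorphic: "conv_identity holomorphic_on ball 0 1"
  unfolding conv_identity_def by (intro holomorphic_intros) auto

lemma conv_identity_circle_integrable:
  "0 < r \<Longrightarrow> r < 1 \<Longrightarrow> circle_integrable (log_mod conv_identity) r"
  by (rule circle_integrable_log_mod[OF conv_identity_holomorphic])
    (auto simp: conv_identity_def)

lemma log_mod_conv_identity: "log_mod conv_identity w = - ln (cmod (1 - w))"
  by (simp add: log_mod_def conv_identity_def norm_divide ln_div)

text \<open>This is the mean value property of the harmonic function log |1 - w|, which vanishes at
  0; it is derived from Cauchy's formula for \<open>Ln (1 - w)\<close>.\<close>

lemma circle_mean_log_conv_identity:
  assumes r: "0 < r" "r < 1"
  shows "(LINT t:{-pi..pi}|lebesgue. log_mod conv_identity (of_real r * cis t)) = 0"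
proof -
  let ?\<gamma> = "part_circlepath 0 r (-pi) pi"
  let ?c = "\<lambda>t. of_real r * cis t :: complex"
  have c: "cmod (?c t) < 1" "?c t \<noteq> 0" for t using r by (auto simp: norm_mult)
  have pos: "0 < Re (1 - w)" if "cmod w < 1" for w
    using complex_Re_le_cmod[of w] that by simp
  have hol: "(\<lambda>w. Ln (1 - w)) holomorphic_on ball 0 1"
    using pos by (intro holomorphic_intros) (force simp: complex_nonpos_Reals_iff)
  have "path_image ?\<gamma> \<subseteq> sphere 0 r"
    using r by (intro path_image_part_circlepath_subset') simp
  then have image: "path_image ?\<gamma> \<subseteq> ball 0 1 - {0}" using r by auto
  \<comment> \<open>The factor \<open>Ln (1 - 0)\<close> is 0, so the right-hand side vanishes
    whatever the winding number is.\<close>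
  have "((\<lambda>w. Ln (1 - w) / (w - 0)) has_contour_integral
      (2 * pi * \<i> * winding_number ?\<gamma> 0 * Ln (1 - 0))) ?\<gamma>"
    by (rule Cauchy_integral_formula_convex_simple[OF convex_ball hol _ _ image])
      (simp_all add: exp_minus)
  then have "((\<lambda>t. Ln (1 - ?c t) / ?c t * r * \<i> * cis t) has_integral 0) {-pi..pi}"
    by (simp add: has_contour_integral_part_circlepath_iff)
  then have "((\<lambda>t. \<i> * Ln (1 - ?c t)) has_integral 0) {-pi..pi}"
    by (rule has_integral_eq[rotated]) (use r in auto)
  \<comment> \<open>The imaginary part of \<open>\<i> * Ln w\<close> is the real part of
    \<open>Ln w\<close>, that is \<open>ln (cmod w)\<close> for nonzero \<open>w\<close>.\<close>
  then have "((\<lambda>t. Im (\<i> * Ln (1 - ?c t))) has_integral Im 0) {-pi..pi}"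
    by (rule has_integral_linear[OF _ bounded_linear_Im, unfolded o_def])
  moreover have "1 - ?c t \<noteq> 0" for t using pos[OF c(1)[of t]] by force
  ultimately have "((\<lambda>t. ln (cmod (1 - ?c t))) has_integral 0) {-pi..pi}"
    by simp
  then have "((\<lambda>t. log_mod conv_identity (?c t)) has_integral 0) {-pi..pi}"
    unfolding log_mod_conv_identity by (rule has_integral_neg[where k = 0, simplified])
  then show ?thesis
    using set_lebesgue_integral_eq_integral(2)[OF conv_identity_circle_integrable[OF r]]
    by (simp add: integral_unique)
qed

lemma set_integral_log_conv_identity_compl:
  assumes "0 < r" "r < 1" "E \<in> sets_of_length l"
  shows "(LINT t:E|lebesgue. log_mod conv_identity (of_real r * cis t)) =
         - (LINT t:{-pi..pi} - E|lebesgue. log_mod conv_identity (of_real r * cis t))"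
proof -
  let ?\<phi> = "\<lambda>t. log_mod conv_identity (of_real r * cis t)"
  have E: "E \<subseteq> {-pi..pi}" "E \<in> sets lebesgue" using assms by (auto simp: sets_of_length_def)
  note I = conv_identity_circle_integrable[OF assms(1,2)]
  have "(LINT t:E \<union> ({-pi..pi} - E)|lebesgue. ?\<phi> t) =
      (LINT t:E|lebesgue. ?\<phi> t) + (LINT t:{-pi..pi} - E|lebesgue. ?\<phi> t)"
    using E by (intro set_integral_Un set_integrable_subset[OF I]) auto
  moreover have "E \<union> ({-pi..pi} - E) = {-pi..pi}" using E by auto
  ultimately show ?thesis using circle_mean_log_conv_identity[OF assms(1,2)] by simp
qed

lemma compl_sets_of_length:
  assumes "E \<in> sets_of_length l"
  shows "{-pi..pi} - E \<in> sets_of_length (2 * pi - l)"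
  using assms measurable_measure_Diff[of "{-pi..pi}" lebesgue E]
  by (auto simp: sets_of_length_def)

text \<open>The sign changes where |1 - w| = 1, and for w = r e^{it} one has |1 - w|^2 = 1 - r (2
  cos t - r).\<close>

lemma log_mod_conv_identity_sign:
  assumes "0 < r" "r < 1"
  shows "r \<le> 2 * cos t \<Longrightarrow> 0 \<le> log_mod conv_identity (of_real r * cis t)"
    and "2 * cos t \<le> r \<Longrightarrow> log_mod conv_identity (of_real r * cis t) \<le> 0"
proof -
  let ?w = "1 - of_real r * cis t"
  have nz: "?w \<noteq> 0"
  proof
    assume "?w = 0"
    then have "cmod (of_real r * cis t) = 1" by simp
    with assms show False by (simp add: norm_mult)
  qed
  have eq: "(cmod ?w)\<^sup>2 = 1 - r * (2 * cos t - r)"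
  proof -
    have "(cmod ?w)\<^sup>2 = (1 - r * cos t)\<^sup>2 + (r * sin t)\<^sup>2"
      by (simp add: cmod_power2)
    then show ?thesis using sin_cos_squared_add[of t] by algebra
  qed
  {
    assume "r \<le> 2 * cos t"
    then have "(cmod ?w)\<^sup>2 \<le> 1" using assms by (simp add: eq)
    then have "cmod ?w \<le> 1" using power2_le_imp_le[of "cmod ?w" 1] by simp
    then show "0 \<le> log_mod conv_identity (of_real r * cis t)"
      using nz by (simp add: log_mod_conv_identity)
  next
    assume "2 * cos t \<le> r"
    then have "1 \<le> (cmod ?w)\<^sup>2" using assms by (simp add: eq mult_le_0_iff)
    then have "1 \<le> cmod ?w" using power2_le_imp_le[of 1 "cmod ?w"] by simp
    then show "log_mod conv_identity (of_real r * cis t) \<le> 0"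
      by (simp add: log_mod_conv_identity)
  }
qed

lemma set_integral_mono_const:
  fixes f :: "real \<Rightarrow> real"
  assumes "set_integrable lebesgue {-pi..pi} f" "E \<in> sets_of_length l"
  shows "(\<And>t. t \<in> E \<Longrightarrow> c \<le> f t) \<Longrightarrow> l * c \<le> (LINT t:E|lebesgue. f t)"
    and "(\<And>t. t \<in> E \<Longrightarrow> f t \<le> c) \<Longrightarrow> (LINT t:E|lebesgue. f t) \<le> l * c"
proof -
  have "set_integrable lebesgue {-pi..pi} (\<lambda>_. c)"
    by (rule absolutely_integrable_continuous_real) simp
  then have c: "set_integrable lebesgue E (\<lambda>_. c)"
    by (rule set_integrable_sets_of_length[OF _ assms(2)])
  note f = set_integrable_sets_of_length[OF assms]
  show "(\<And>t. t \<in> E \<Longrightarrow> c \<le> f t) \<Longrightarrow> l * c \<le> (LINT t:E|lebesgue. f t)"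
    using set_integral_mono[OF c f] set_integral_const_sets_of_length[OF assms(2)] by simp
  show "(\<And>t. t \<in> E \<Longrightarrow> f t \<le> c) \<Longrightarrow> (LINT t:E|lebesgue. f t) \<le> l * c"
    using set_integral_mono[OF f c] set_integral_const_sets_of_length[OF assms(2)] by simp
qed

lemma baernstein_star_conv_identity_nonneg:
  assumes z: "z \<in> upper_half_disk"
  shows "0 \<le> baernstein_star (log_mod conv_identity) z"
proof -
  note zD = upper_half_diskD[OF z]
  let ?r = "cmod z" and ?\<theta> = "Arg z"
  let ?\<phi> = "\<lambda>t. log_mod conv_identity (of_real ?r * cis t)"
  \<comment> \<open>A single admissible set with nonnegative integral bounds the supremum from
    below; the arc centred at the singularity 1 of I is such a set.\<close>
  let ?E = "{-?\<theta>..?\<theta>}"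
  note I = conv_identity_circle_integrable[OF zD(1,2)]
  have E: "?E \<in> sets_of_length (2 * ?\<theta>)"
    using zD by (intro symmetric_interval_in_sets_of_length) auto
  \<comment> \<open>The integrand is decreasing in \<open>\<bar>t\<bar>\<close> with mean 0: it is nonnegative on \<open>?E\<close> or nonpositive
      off \<open>?E\<close>.\<close>
  have "0 \<le> (LINT t:?E|lebesgue. ?\<phi> t)"
  proof (cases "?r \<le> 2 * cos ?\<theta>")
    case True
    have "0 \<le> ?\<phi> t" if "t \<in> ?E" for t
    proof -
      have "cos ?\<theta> \<le> cos \<bar>t\<bar>"
        using that zD by (intro cos_monotone_0_pi_le) auto
      then show ?thesis using True zD by (intro log_mod_conv_identity_sign(1)) auto
    qed
    then show ?thesis using set_integral_mono_const(1)[OF I E, of 0] by simp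
  next
    case False
    have "?\<phi> t \<le> 0" if "t \<in> {-pi..pi} - ?E" for t
    proof -
      have "cos \<bar>t\<bar> \<le> cos ?\<theta>"
        using that zD by (intro cos_monotone_0_pi_le) auto
      then show ?thesis using False zD by (intro log_mod_conv_identity_sign(2)) auto
    qed
    then have "(LINT t:{-pi..pi} - ?E|lebesgue. ?\<phi> t) \<le> 0"
      using set_integral_mono_const(2)[OF I compl_sets_of_length[OF E], of 0] by simp
    then show ?thesis
      using set_integral_log_conv_identity_compl[OF zD(1,2) E] by simp
  qed
  also have "\<dots> \<le> baernstein_star (log_mod conv_identity) z"
    by (rule set_integral_le_baernstein_star[OF I E])
  finally show ?thesis .
qed

text \<open>By the zero mean, the integral over a set is minus the integral over its complement. The
  complement has length 2 (pi - Arg z), and log |I| is at least - ln 2 there because |1 - w| \<le>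
  2.\<close>

lemma baernstein_star_conv_identity_le:
  assumes z: "z \<in> upper_half_disk"
  shows "baernstein_star (log_mod conv_identity) z \<le> 2 * (pi - Arg z) * ln 2"
proof (rule baernstein_star_le[OF z])
  note zD = upper_half_diskD[OF z]
  let ?\<phi> = "\<lambda>t. log_mod conv_identity (of_real (cmod z) * cis t)"
  note I = conv_identity_circle_integrable[OF zD(1,2)]
  fix E assume E: "E \<in> sets_of_length (2 * Arg z)"
  have lower: "- ln 2 \<le> ?\<phi> t" for t
  proof -
    let ?w = "of_real (cmod z) * cis t"
    have w: "cmod ?w < 1" using zD by (simp add: norm_mult)
    then have "1 - ?w \<noteq> 0" by auto
    moreover have "cmod (1 - ?w) \<le> 2" using norm_triangle_ineq4[of 1 ?w] w by simp
    ultimately show ?thesis by (simp add: log_mod_conv_identity)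
  qed
  have "(2 * pi - 2 * Arg z) * - ln 2 \<le> (LINT t:{-pi..pi} - E|lebesgue. ?\<phi> t)"
    by (rule set_integral_mono_const(1)[OF I compl_sets_of_length[OF E] lower])
  then show "(LINT t:E|lebesgue. ?\<phi> t) \<le> 2 * (pi - Arg z) * ln 2"
    using set_integral_log_conv_identity_compl[OF zD(1,2) E] by (simp add: algebra_simps)
qed

text \<open>The integrand is constant on the circle, so all admissible sets give the same
  integral.\<close>

lemma baernstein_star_monomial:
  assumes z: "z \<in> upper_half_disk" and c: "c \<noteq> 0"
  shows "baernstein_star (log_mod (\<lambda>w. c * w)) z = 2 * Arg z * ln (cmod c * cmod z)"
proof -
  note zD = upper_half_diskD[OF z]
  have *: "(LINT t:E|lebesgue. log_mod (\<lambda>w. c * w) (of_real (cmod z) * cis t)) =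
        2 * Arg z * ln (cmod c * cmod z)" if "E \<in> sets_of_length (2 * Arg z)" for E
    using set_integral_const_sets_of_length[OF that] by (simp add: log_mod_def norm_mult)
  have "{-Arg z..Arg z} \<in> sets_of_length (2 * Arg z)"
    using zD by (intro symmetric_interval_in_sets_of_length) auto
  then have "(SUP E\<in>sets_of_length (2 * Arg z). 2 * Arg z * ln (cmod c * cmod z)) =
      2 * Arg z * ln (cmod c * cmod z)"
    by (intro cSUP_const) auto
  then show ?thesis unfolding baernstein_star_def sets_of_length_def[symmetric] by (simp add: *)
qed

section \<open>Hadamard products with I and with z\<close>

lemma fps_nth_fps_expansion_conv_identity: "fps_nth (fps_expansion conv_identity 0) n = 1"
proof -
  have "(\<lambda>z. inverse (1 - z) :: complex) has_fps_expansion inverse (1 - fps_X)"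
    by (intro fps_expansion_intros) auto
  then have "conv_identity has_fps_expansion inverse (1 - fps_X)"
    by (simp add: conv_identity_def[abs_def] inverse_eq_divide)
  \<comment> \<open>Uniqueness of power series identifies the analytic expansion with the formal
    geometric series, whose coefficients are all 1.\<close>
  then have "fps_expansion conv_identity 0 = inverse (1 - fps_X)"
    using has_fps_expansion_fps_expansion[OF _ _ conv_identity_holomorphic]
      fps_expansion_unique_complex by auto
  then show ?thesis by (simp add: fps_inverse_one_minus_fps_X)
qed

lemma hadamard_conv_identity:
  assumes "cmod z < 1"
  shows "(conv_identity \<star> conv_identity) z = conv_identity z"
  using suminf_geometric[OF assms]
  by (simp add: hadamard_conv_def fps_nth_fps_expansion_conv_identity conv_identity_def)

text \<open>Only the term \<open>n = 1\<close> survives, and \<open>fps_expansion\<close> is defined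
  by derivatives at 0.\<close>

lemma hadamard_conv_ident: "(f \<star> (\<lambda>z. z)) = (\<lambda>z. deriv f 0 * z)"
proof -
  have "fps_expansion (\<lambda>z. z) 0 = (fps_X :: complex fps)"
    using has_fps_expansion_fps_expansion[of UNIV "\<lambda>z. z"] has_fps_expansion_fps_X
      fps_expansion_unique_complex by auto
  then have "fps_nth (fps_expansion f 0) n * fps_nth (fps_expansion (\<lambda>z. z) 0) n * z ^ n =
      (if n = 1 then deriv f 0 * z else 0)" for n z
    by (simp add: fps_expansion_def)
  then show ?thesis
    unfolding hadamard_conv_def
    by (simp only: sums_unique[OF sums_single[of 1 "\<lambda>_. deriv f 0 * _"], symmetric])
qed

section \<open>The first factor and its leading coefficient\<close>

text \<open>The factor is chosen without zeros in the disk, so that the junk value \<open>ln 0 = 0\<close> never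
  enters \<open>log_mod F\<^sub>1\<close>.\<close>

definition F\<^sub>1 :: "complex \<Rightarrow> complex" where
  "F\<^sub>1 z = csqrt ((1 + z) / 2) / (1 - z)"

text \<open>This keeps the argument of \<open>csqrt\<close> off the branch cut and away from 0,
  which gives both holomorphy and absence of zeros.\<close>

lemma half_not_nonpos_Reals:
  assumes "cmod w < 1"
  shows "(1 + w) / 2 \<notin> \<real>\<^sub>\<le>\<^sub>0"
proof -
  have "0 < Re ((1 + w) / 2)" using abs_Re_le_cmod[of w] assms by simp
  then show ?thesis by (auto simp: complex_nonpos_Reals_iff)
qed

lemma F1_holomorphic: "F\<^sub>1 holomorphic_on ball 0 1"
  unfolding F\<^sub>1_def[abs_def] using half_not_nonpos_Reals by (intro holomorphic_intros) auto

lemma F1_nonzero: "cmod w < 1 \<Longrightarrow> F\<^sub>1 w \<noteq> 0"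
  using half_not_nonpos_Reals[of w] by (auto simp: F\<^sub>1_def)

lemma log_mod_F1_le:
  assumes "cmod w < 1"
  shows "log_mod F\<^sub>1 w \<le> log_mod conv_identity w"
proof -
  have "cmod ((1 + w) / 2) \<le> 1" using norm_triangle_ineq[of 1 w] assms by (simp add: norm_divide)
  then have "cmod (csqrt ((1 + w) / 2)) \<le> 1" by (simp add: norm_csqrt)
  then have "cmod (F\<^sub>1 w) \<le> cmod (conv_identity w)"
    by (simp add: F\<^sub>1_def conv_identity_def norm_divide divide_right_mono)
  then show ?thesis using F1_nonzero[OF assms] unfolding log_mod_def by (intro ln_mono) auto
qed

lemma deriv_F1: "deriv F\<^sub>1 0 = of_real (3 / (2 * sqrt 2))"
proof -
  \<comment> \<open>Since 1/(1 - z) has value and derivative 1 at 0, the product rule gives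
    \<omega>'(0) + \<omega>(0) for \<omega>(z) = \<open>csqrt ((1 + z) / 2)\<close>.\<close>
  have "(F\<^sub>1 has_field_derivative 1 / (4 * csqrt (1/2)) + csqrt (1/2)) (at 0)"
    unfolding F\<^sub>1_def[abs_def] by (auto intro!: derivative_eq_intros simp: complex_nonpos_Reals_iff)
  then have "deriv F\<^sub>1 0 = 1 / (4 * csqrt (1/2)) + csqrt (1/2)" by (rule DERIV_imp_deriv)
  also have "csqrt (1/2) = of_real (1 / sqrt 2)"
    using csqrt_of_real[of "1/2"] by (simp add: real_sqrt_divide)
  also have "1 / (4 * of_real (1 / sqrt 2)) + of_real (1 / sqrt 2) =
      (of_real (1 / (4 * (1 / sqrt 2)) + 1 / sqrt 2) :: complex)"
    by simp
  also have "1 / (4 * (1 / sqrt 2)) + 1 / sqrt 2 = 3 / (2 * sqrt 2)"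
    by (simp add: field_simps)
  finally show ?thesis .
qed

section \<open>Failure of the inequality near the negative real axis\<close>

lemma baernstein_star_conv_identity_less:
  "\<exists>z \<in> upper_half_disk. baernstein_star (log_mod conv_identity) z
      < baernstein_star (log_mod (\<lambda>w. deriv F\<^sub>1 0 * w)) z"
proof -
  \<comment> \<open>\<open>L\<close> is log (a r) for a = \<open>deriv F\<^sub>1 0\<close> and the
    radius r = 99/100.\<close>
  define L where "L = ln (3 / (2 * sqrt 2) * (99 / 100))"
  \<comment> \<open>At the angle pi (1 - \<delta>), bounding ln 2 by 1 reduces the claim to \<delta>
    < (1 - \<delta>) L, that is \<delta> < L / (L + 1); half of this threshold is taken.\<close>
  define \<delta> where "\<delta> = L / (2 * (L + 1))"
  define z where "z = of_real (99 / 100) * cis (pi * (1 - \<delta>))"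
  \<comment> \<open>As 297/200 = (3/2) (99/100), this says exactly that a r > 1.\<close>
  have "sqrt 2 < 297 / 200" by (rule real_less_lsqrt) (auto simp: power2_eq_square)
  then have "1 < 3 / (2 * sqrt 2) * (99 / 100)" by (simp add: field_simps)
  then have L: "0 < L" by (simp add: L_def)
  then have \<delta>: "0 < \<delta>" "\<delta> < 1" by (simp_all add: \<delta>_def field_simps)
  then have ang: "0 < pi * (1 - \<delta>)" "pi * (1 - \<delta>) < pi" by (simp_all add: mult_less_cancel_left1)
  then have z: "z \<in> upper_half_disk"
    unfolding z_def upper_half_disk_def
    by (intro CollectI exI[of _ "99 / 100"] exI[of _ "pi * (1 - \<delta>)"]) auto
  have norm_z: "cmod z = 99 / 100" by (simp add: z_def norm_mult)
  have "pi * (1 - \<delta>) \<in> {-pi<..pi}"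
    using ang pi_gt_zero unfolding greaterThanAtMost_iff by (intro conjI; linarith)
  then have Arg_z: "Arg z = pi * (1 - \<delta>)"
    unfolding z_def by (subst Arg_times_of_real) (auto intro: Arg_cis)
  have "baernstein_star (log_mod conv_identity) z \<le> 2 * (pi - Arg z) * ln 2"
    by (rule baernstein_star_conv_identity_le[OF z])
  also have "\<dots> \<le> 2 * (pi - Arg z) * 1"
    using ang ln_le_minus_one[of "2::real"] by (intro mult_left_mono) (auto simp: Arg_z)
  also have "\<dots> = 2 * pi * \<delta>" by (simp add: Arg_z algebra_simps)
  also have "\<dots> < 2 * pi * ((1 - \<delta>) * L)"
  proof -
    have "\<delta> * (L + 1) = L / 2" using L by (simp add: \<delta>_def divide_simps)
    then have "\<delta> < (1 - \<delta>) * L" using L by (simp add: algebra_simps)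
    then show ?thesis by simp
  qed
  also have "\<dots> = baernstein_star (log_mod (\<lambda>w. deriv F\<^sub>1 0 * w)) z"
    by (subst baernstein_star_monomial[OF z])
      (simp_all add: deriv_F1 norm_z Arg_z L_def norm_divide norm_mult)
  finally show ?thesis using z by blast
qed

text \<open>The series agrees with 1/(1 - w) for |w| < 1, and the star-function at z sees only the
  circle |w| = |z| < 1.\<close>

lemma baernstein_star_hadamard_conv_identity:
  "z \<in> upper_half_disk \<Longrightarrow> baernstein_star (log_mod (conv_identity \<star> conv_identity)) z
     = baernstein_star (log_mod conv_identity) z"
  by (rule baernstein_star_cong) (simp_all add: log_mod_def hadamard_conv_identity)

theorem theorem2:
  shows "(\<forall>z \<in> ball 0 1. (conv_identity \<star> conv_identity) z = conv_identity z) \<and>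
    (\<exists>F1 F2 :: complex \<Rightarrow> complex.
       F1 holomorphic_on ball 0 1 \<and> F2 holomorphic_on ball 0 1 \<and>
       (\<exists>z \<in> ball 0 1. F1 z \<noteq> 0) \<and> (\<exists>z \<in> ball 0 1. F2 z \<noteq> 0) \<and>
       (\<exists>z \<in> ball 0 1. (F1 \<star> F2) z \<noteq> 0) \<and>
       (\<forall>z \<in> upper_half_disk.
          baernstein_star (log_mod F1) z \<le> baernstein_star (log_mod conv_identity) z) \<and>
       (\<forall>z \<in> upper_half_disk.
          baernstein_star (log_mod F2) z \<le> baernstein_star (log_mod conv_identity) z) \<and>
       \<not> (\<forall>z \<in> upper_half_disk.
          baernstein_star (log_mod (F1 \<star> F2)) z
            \<le> baernstein_star (log_mod (conv_identity \<star> conv_identity)) z))"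
proof (rule conjI, use hadamard_conv_identity in force,
    rule exI[of _ "F\<^sub>1"], rule exI[of _ "\<lambda>z. z"], intro conjI ballI)
  show "F\<^sub>1 holomorphic_on ball 0 1" by (rule F1_holomorphic)
  show "(\<lambda>z. z) holomorphic_on ball 0 1" by simp
  show "\<exists>z\<in>ball 0 1. F\<^sub>1 z \<noteq> 0" using F1_nonzero[of 0] by force
  show "\<exists>z\<in>ball 0 1. z \<noteq> (0::complex)" by (rule bexI[of _ "1/2"]) auto
  show "\<exists>z\<in>ball 0 1. (F\<^sub>1 \<star> (\<lambda>z. z)) z \<noteq> 0"
    by (rule bexI[of _ "1/2"]) (auto simp: hadamard_conv_ident deriv_F1)
  fix z assume z: "z \<in> upper_half_disk"
  note zD = upper_half_diskD[OF z]
  show "baernstein_star (log_mod F\<^sub>1) z \<le> baernstein_star (log_mod conv_identity) z"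
    using zD by (intro baernstein_star_mono[OF z] log_mod_F1_le conv_identity_circle_integrable
        circle_integrable_log_mod[OF F1_holomorphic] F1_nonzero)
  have "baernstein_star (log_mod (\<lambda>z. z)) z \<le> 0"
    using baernstein_star_monomial[OF z, of 1] zD by (simp add: mult_nonneg_nonpos)
  also have "0 \<le> baernstein_star (log_mod conv_identity) z"
    by (rule baernstein_star_conv_identity_nonneg[OF z])
  finally show "baernstein_star (log_mod (\<lambda>z. z)) z \<le> baernstein_star (log_mod conv_identity) z" .
next
  show "\<not> (\<forall>z \<in> upper_half_disk. baernstein_star (log_mod (F\<^sub>1 \<star> (\<lambda>z. z))) z
            \<le> baernstein_star (log_mod (conv_identity \<star> conv_identity)) z)"
    using baernstein_star_conv_identity_less baernstein_star_hadamard_conv_identity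
    by (auto simp: hadamard_conv_ident not_le)
qed

end
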